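(* Let $\Omega=[0,1]$ and let $f\in L^2(\Omega)$. Then there exists $h\in W_0^{1,2}(\Omega)$ such that $$f(x)=\int_\Omega f(t)\,dt+Dh(x)\qquad\text{for almost every } x\in\Omega,$$ where the sum is a sum of elements from mutually orthogonal sets: the constant function $\int_\Omega f(t)\,dt$ belongs to $A^2(\Omega)$, $Dh$ belongs to $D(W_0^{1,2}(\Omega))$, and $A^2(\Omega)$ and $D(W_0^{1,2}(\Omega))$ are orthogonal to each other in $L^2(\Omega)$.
   Context: $\Omega=[0,1]$, $\partial\Omega=\{0,1\}$, and $D=\frac{d}{dx}$ (weak derivative). $L^2(\Omega)$ is the real Hilbert space of (classes of) measurable functions $f:\Omega\to\mathbb{R}$ with $\int_\Omega f^2\,dx<\infty$, with inner product $\langle f,g\rangle=\int_\Omega f(x)g(x)\,dx$. $W^{1,2}(\Omega)=\{f\in L^2(\Omega): Df\in L^2(\Omega)\}$, and $W_0^{1,2}(\Omega)=\{f\in W^{1,2}(\Omega): f|_{\partial\Omega}=0\}$, where the restriction to $\partial\Omega$ is in the sense of trace (boundary values of the continuous representative). $D(W_0^{1,2}(\Omega))=\{Dh: h\in W_0^{1,2}(\Omega)\}$. $A^2(\Omega)=\{g\in L^2(\Omega): Dg=0 \text{ on } \Omega\}$, i.e. the space of constant functions. *)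

theory Defs
  imports "HOL-Analysis.Analysis"
begin

text \<open>
  Elements of function spaces over the unit interval are represented by functions on the
  real line of which only the values on the interval matter. Equality of classes is almost
  everywhere equality, and all sets of functions below are closed under it.
\<close>

abbreviation Omega :: "real set" where
  "Omega \<equiv> {0..1}"

definition L2 :: "(real \<Rightarrow> real) set" where
  "L2 = {f. f \<in> borel_measurable (lebesgue_on Omega) \<and>
            integrable (lebesgue_on Omega) (\<lambda>x. (f x)\<^sup>2)}"

definition L2_inner :: "(real \<Rightarrow> real) \<Rightarrow> (real \<Rightarrow> real) \<Rightarrow> real" where
  "L2_inner f g = (LINT x|lebesgue_on Omega. f x * g x)"

definition smooth :: "(real \<Rightarrow> real) \<Rightarrow> bool" where
  "smooth \<phi> \<longleftrightarrow> (\<forall>n x. (deriv ^^ n) \<phi> field_differentiable at x)"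

definition test_functions :: "real set \<Rightarrow> (real \<Rightarrow> real) set" where
  "test_functions U = {\<phi>. smooth \<phi> \<and> compact (closure {x. \<phi> x \<noteq> 0}) \<and>
                          closure {x. \<phi> x \<noteq> 0} \<subseteq> U}"

definition locally_integrable_on :: "(real \<Rightarrow> real) \<Rightarrow> real set \<Rightarrow> bool" where
  "locally_integrable_on f U \<longleftrightarrow> (\<forall>K. compact K \<longrightarrow> K \<subseteq> U \<longrightarrow> f absolutely_integrable_on K)"

text \<open>
  Weak derivatives are determined only almost everywhere, so the operator \<open>D\<close> is a relation:
  \<open>has_weak_derivative f g\<close> means that \<open>g\<close> represents the class \<open>D f\<close>. Test functions are
  supported in the interior of the interval.
\<close>

definition has_weak_derivative :: "(real \<Rightarrow> real) \<Rightarrow> (real \<Rightarrow> real) \<Rightarrow> bool" where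
  "has_weak_derivative f g \<longleftrightarrow>
     locally_integrable_on f (interior Omega) \<and> locally_integrable_on g (interior Omega) \<and>
     (\<forall>\<phi>\<in>test_functions (interior Omega).
        (LINT x|lebesgue_on Omega. f x * deriv \<phi> x) = - (LINT x|lebesgue_on Omega. g x * \<phi> x))"

definition W12 :: "(real \<Rightarrow> real) set" where
  "W12 = {f \<in> L2. \<exists>g\<in>L2. has_weak_derivative f g}"

text \<open>
  The trace on the boundary consists of the boundary values of the continuous representative,
  which is unique on the closed interval.
\<close>

definition continuous_representative :: "(real \<Rightarrow> real) \<Rightarrow> (real \<Rightarrow> real) \<Rightarrow> bool" where
  "continuous_representative f u \<longleftrightarrow>
     continuous_on Omega u \<and> (AE x in lebesgue_on Omega. f x = u x)"

definition W12_0 :: "(real \<Rightarrow> real) set" where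
  "W12_0 = {f \<in> W12. \<exists>u. continuous_representative f u \<and> (\<forall>x\<in>frontier Omega. u x = 0)}"

definition D_W12_0 :: "(real \<Rightarrow> real) set" where
  "D_W12_0 = {g \<in> L2. \<exists>h\<in>W12_0. has_weak_derivative h g}"

definition A2 :: "(real \<Rightarrow> real) set" where
  "A2 = {g \<in> L2. has_weak_derivative g (\<lambda>x. 0)}"

end

theory Submission
  imports Defs
begin

text \<open>
  Put \<open>c = \<integral> f\<close> and let \<open>h\<close> be the primitive of \<open>f - c\<close> vanishing at \<open>0\<close>; it also
  vanishes at \<open>1\<close>, and Fubini's theorem shows that \<open>f - c\<close> is its weak derivative.
  For the orthogonality one needs that a function with weak derivative \<open>0\<close> is constant almost
  everywhere: testing against primitives of mean-zero combinations of two bump functions and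
  letting these increase to indicator functions gives
  \<open>\<integral>\<^bsub>a\<^esub>\<^bsup>b\<^esup> u = (b - a) \<integral> u\<close> for all subintervals, and Lebesgue's
  differentiation theorem applies. Consequently \<open>h \<in> W\<^sub>0\<close> differs from the primitive of
  \<open>D h\<close> by a constant, so \<open>D h\<close> has mean zero and is orthogonal to constants.
\<close>

section \<open>Smooth bump functions\<close>

text \<open>For \<open>p = 1\<close> this is the classical function \<open>exp (- 1 / x)\<close>,
  flat at 0. Its derivatives are polynomials in \<open>1 / x\<close> times the same exponential, so
  the parameter \<open>p\<close> makes one derivative formula cover all orders.\<close>

definition poly_bump :: "real poly \<Rightarrow> real \<Rightarrow> real" where
  "poly_bump p x = (if x > 0 then poly p (1 / x) * exp (- (1 / x)) else 0)"

lemma tendsto_poly_mult_exp_minus: "((\<lambda>y. poly p y * exp (- y)) \<longlongrightarrow> (0::real)) at_top"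
proof -
  have "((\<lambda>y. \<Sum>i\<le>degree p. coeff p i * (y ^ i / exp y)) \<longlongrightarrow> (\<Sum>i\<le>degree p. coeff p i * 0)) at_top"
    by (intro tendsto_sum tendsto_mult tendsto_const tendsto_power_div_exp_0)
  then show ?thesis
    by (simp add: poly_altdef sum_distrib_right exp_minus divide_inverse mult.assoc)
qed

text \<open>With \<open>y = 1 / x\<close> and \<open>y' = - y^2\<close>, the chain rule turns
  \<open>p(y) exp(-y)\<close> into \<open>y^2 (p(y) - p'(y)) exp(-y)\<close>; the polynomial
  \<open>[:0, 0, 1:]\<close> is the factor \<open>y^2\<close>. At 0 the exponential beats every
  polynomial.\<close>

lemma DERIV_poly_bump:
  "(poly_bump p has_real_derivative poly_bump ([:0, 0, 1:] * (p - pderiv p)) x) (at x)"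
proof -
  consider "x > 0" | "x < 0" | "x = 0" by linarith
  then show ?thesis
  proof cases
    case 1
    have "((\<lambda>x. poly p (1 / x) * exp (- (1 / x))) has_real_derivative
            poly_bump ([:0, 0, 1:] * (p - pderiv p)) x) (at x)"
      using 1 by (auto intro!: derivative_eq_intros DERIV_chain'[OF _ poly_DERIV]
          simp: poly_bump_def field_simps power2_eq_square)
    then show ?thesis
      by (rule has_field_derivative_transform_within_open[of _ _ _ "{0<..}"])
        (use 1 in \<open>auto simp: poly_bump_def\<close>)
  next
    case 2
    have "((\<lambda>x. 0) has_real_derivative 0) (at x)" by simp
    then have "(poly_bump p has_real_derivative 0) (at x)"
      by (rule has_field_derivative_transform_within_open[of _ _ _ "{..<0}"])
        (use 2 in \<open>auto simp: poly_bump_def\<close>)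
    then show ?thesis using 2 by (simp add: poly_bump_def)
  next
    case 3
    have "((\<lambda>h. poly_bump p h / h) \<longlongrightarrow> 0) (at 0)"
    proof (rule filterlim_split_at)
      \<comment> \<open>The factor \<open>[:0, 1:]\<close> absorbs the division by \<open>h\<close>:
        the difference quotient is again a polynomial in \<open>1 / h\<close> times the
        exponential.\<close>
      have "((\<lambda>h::real. poly ([:0, 1:] * p) (inverse h) * exp (- inverse h)) \<longlongrightarrow> 0) (at_right 0)"
        by (rule filterlim_compose[OF tendsto_poly_mult_exp_minus filterlim_inverse_at_top_right])
      then show "((\<lambda>h. poly_bump p h / h) \<longlongrightarrow> 0) (at_right 0)"
        by (rule Lim_transform_eventually)
          (auto simp: eventually_at_filter poly_bump_def field_simps)
      show "((\<lambda>h. poly_bump p h / h) \<longlongrightarrow> 0) (at_left 0)"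
        by (rule tendsto_eventually) (auto simp: eventually_at_filter poly_bump_def)
    qed
    then show ?thesis
      using 3 by (simp add: DERIV_def poly_bump_def)
  qed
qed

text \<open>Affine arguments allow scaling, translation and reflection, products combine two
  one-sided bumps into one of compact support, and sums with constants give linear combinations.
  Closure under differentiation is what yields smoothness.\<close>

inductive_set bump_algebra :: "(real \<Rightarrow> real) set" where
  poly_bump: "(\<lambda>x. poly_bump p (a * x + b)) \<in> bump_algebra"
| const: "(\<lambda>x. c) \<in> bump_algebra"
| add: "f \<in> bump_algebra \<Longrightarrow> g \<in> bump_algebra \<Longrightarrow> (\<lambda>x. f x + g x) \<in> bump_algebra"
| mult: "f \<in> bump_algebra \<Longrightarrow> g \<in> bump_algebra \<Longrightarrow> (\<lambda>x. f x * g x) \<in> bump_algebra"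

lemma bump_algebra_DERIV:
  "f \<in> bump_algebra \<Longrightarrow> \<exists>g\<in>bump_algebra. \<forall>x. (f has_real_derivative g x) (at x)"
proof (induction rule: bump_algebra.induct)
  case (poly_bump p a b)
  have "((\<lambda>x. poly_bump p (a * x + b)) has_real_derivative
      a * poly_bump ([:0, 0, 1:] * (p - pderiv p)) (a * x + b)) (at x)" for x
    by (rule DERIV_chain'[OF _ DERIV_poly_bump, THEN DERIV_cong])
      (auto intro!: derivative_eq_intros)
  moreover have "(\<lambda>x. a * poly_bump ([:0, 0, 1:] * (p - pderiv p)) (a * x + b)) \<in> bump_algebra"
    by (intro bump_algebra.mult bump_algebra.const bump_algebra.poly_bump)
  ultimately show ?case by (intro bexI) auto
next
  case (const c)
  show ?case by (intro bexI[OF _ bump_algebra.const[of 0]]) simp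
next
  case (add f g)
  then obtain f' g' where "f' \<in> bump_algebra" "g' \<in> bump_algebra"
    "\<And>x. (f has_real_derivative f' x) (at x)" "\<And>x. (g has_real_derivative g' x) (at x)"
    by blast
  then show ?case
    by (intro bexI[OF _ bump_algebra.add[of f' g']]) (auto intro: DERIV_add)
next
  case (mult f g)
  then obtain f' g' where *: "f' \<in> bump_algebra" "g' \<in> bump_algebra"
    "\<And>x. (f has_real_derivative f' x) (at x)" "\<And>x. (g has_real_derivative g' x) (at x)"
    by blast
  have "((\<lambda>x. f x * g x) has_real_derivative f' x * g x + g' x * f x) (at x)" for x
    by (rule DERIV_mult) (use * in auto)
  then show ?case
    using * mult by (intro bexI[OF _ bump_algebra.add[OF bump_algebra.mult[of f' g] bump_algebra.mult[of g' f]]]) auto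
qed

lemma smooth_bump_algebra:
  assumes "f \<in> bump_algebra"
  shows "smooth f"
proof -
  have *: "(deriv ^^ n) f \<in> bump_algebra" for n
  proof (induction n)
    case (Suc n)
    then obtain g where g: "g \<in> bump_algebra" "\<And>x. ((deriv ^^ n) f has_real_derivative g x) (at x)"
      using bump_algebra_DERIV by blast
    then have "deriv ((deriv ^^ n) f) = g"
      by (auto intro!: DERIV_imp_deriv)
    with g show ?case by simp
  qed (use assms in simp)
  show ?thesis
    unfolding smooth_def field_differentiable_def using bump_algebra_DERIV[OF *] by blast
qed

section \<open>Calculus of smooth functions and test functions\<close>

lemma smooth_imp_DERIV: "smooth f \<Longrightarrow> (f has_real_derivative deriv f x) (at x)"
  unfolding smooth_def by (metis DERIV_deriv_iff_field_differentiable funpow_0)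

lemma smooth_imp_continuous_on: "smooth f \<Longrightarrow> continuous_on A f"
  by (meson DERIV_isCont continuous_at_imp_continuous_on smooth_imp_DERIV)

lemma smooth_deriv: "smooth f \<Longrightarrow> smooth (deriv f)"
  unfolding smooth_def by (metis comp_apply funpow_Suc_right)

lemma smooth_antiderivative:
  assumes "smooth f" and F: "\<And>x. (F has_real_derivative f x) (at x)"
  shows "smooth F"
  unfolding smooth_def
proof (intro allI)
  fix n x
  have "deriv F = f" using F by (auto intro!: DERIV_imp_deriv)
  then show "(deriv ^^ n) F field_differentiable at x"
    using assms
    by (cases n) (auto simp: smooth_def field_differentiable_def funpow_Suc_right simp del: funpow.simps)
qed

lemma test_functionI:
  assumes "smooth f" "\<And>x. x \<notin> {s..t} \<Longrightarrow> f x = 0" "{s..t} \<subseteq> U"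
  shows "f \<in> test_functions U"
proof -
  have "{x. f x \<noteq> 0} \<subseteq> {s..t}" using assms(2) by blast
  then have "closure {x. f x \<noteq> 0} \<subseteq> {s..t}" "bounded {x. f x \<noteq> 0}"
    by (auto intro: closure_minimal[THEN subsetD] bounded_subset[OF bounded_closed_interval])
  then show ?thesis
    using assms unfolding test_functions_def by auto
qed

lemma test_functionD:
  assumes "f \<in> test_functions U"
  shows "smooth f" "x \<notin> U \<Longrightarrow> f x = 0"
  using assms closure_subset[of "{x. f x \<noteq> 0}"] by (auto simp: test_functions_def)

text \<open>The primitive starting at \<open>a\<close> vanishes left of \<open>s\<close> because
  \<psi> does, and right of \<open>t\<close> because the total integral is zero; hence it has
  compact support in the open interval.\<close>

lemma mean_zero_imp_deriv_test_function:
  assumes \<psi>: "smooth \<psi>" and supp: "\<And>x. x \<notin> {s..t} \<Longrightarrow> \<psi> x = 0"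
    and st: "a < s" "s \<le> t" "t < b" and mean: "integral {a..b} \<psi> = 0"
  shows "\<exists>\<phi>\<in>test_functions {a<..<b}. deriv \<phi> = \<psi>"
proof -
  have cont: "continuous_on A \<psi>" for A
    using \<psi> by (rule smooth_imp_continuous_on)
  define \<phi> where "\<phi> x = (LBINT y=a..x. \<psi> y)" for x :: real
  have deriv: "(\<phi> has_real_derivative \<psi> x) (at x)" for x
  proof -
    \<comment> \<open>The window has both \<open>a\<close> and \<open>x\<close> in its interior, so
      the one-interval form of the fundamental theorem gives a full derivative at \<open>x\<close>,
      also for \<open>x < a\<close>.\<close>
    have "(\<phi> has_vector_derivative \<psi> x) (at x within {min a x - 1..max a x + 1})"
      unfolding \<phi>_def by (rule interval_integral_FTC2) (auto simp: cont)
    then have "(\<phi> has_vector_derivative \<psi> x) (at x within {min a x - 1<..<max a x + 1})"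
      by (rule has_vector_derivative_within_subset) auto
    moreover have "at x within {min a x - 1<..<max a x + 1} = at x"
      by (rule at_within_open) auto
    ultimately show ?thesis
      by (simp add: has_real_derivative_iff_has_vector_derivative)
  qed
  have \<phi>_b: "\<phi> b = 0"
  proof -
    have "set_integrable lborel {a..b} \<psi>"
      by (rule borel_integrable_atLeastAtMost') (rule cont)
    then show ?thesis
      unfolding \<phi>_def using st mean by (subst interval_integral_eq_integral) auto
  qed
  \<comment> \<open>On a convex set avoiding the support of \<psi> the primitive is constant, so a
    single zero \<open>c\<close> there suffices: \<open>a\<close> on the left, \<open>b\<close> on
    the right.\<close>
  have zero: "\<phi> x = 0" if "x \<in> S" "c \<in> S" "\<phi> c = 0" "convex S" "S \<inter> {s..t} = {}" for x c S
  proof -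
    have "\<exists>k. \<forall>x\<in>S. \<phi> x = k"
    proof (rule has_field_derivative_zero_constant)
      fix y assume "y \<in> S"
      then have "\<psi> y = 0" using supp that(5) by blast
      with deriv[of y] show "(\<phi> has_field_derivative 0) (at y within S)"
        by (metis has_field_derivative_at_within)
    qed (use that in simp)
    with that show ?thesis by metis
  qed
  have "\<phi> x = 0" if "x \<notin> {s..t}" for x
  proof (cases "x < s")
    case True
    show ?thesis by (rule zero[of _ "{..<s}" a]) (use True st in \<open>auto simp: \<phi>_def\<close>)
  next
    case False
    show ?thesis by (rule zero[of _ "{t<..}" b]) (use False st that \<phi>_b in auto)
  qed
  then have "\<phi> \<in> test_functions {a<..<b}"
    using st by (intro test_functionI[of _ s t] smooth_antiderivative[OF \<psi> deriv]) auto
  moreover have "deriv \<phi> = \<psi>"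
    using deriv by (auto intro!: DERIV_imp_deriv)
  ultimately show ?thesis by blast
qed

section \<open>Weak derivatives of primitives\<close>

text \<open>A smooth function is bounded on the compact interval, so a multiple of
  \<open>\<bar>u\<bar>\<close> dominates. Taking \<open>u = 1\<close> yields integrability of \<psi>
  itself.\<close>

lemma integrable_mult_smooth:
  assumes "integrable (lebesgue_on {a..b}) u" "smooth \<psi>"
  shows "integrable (lebesgue_on {a..b}) (\<lambda>x. u x * \<psi> x)"
proof (cases "{a..b} = {}")
  case False
  have cont: "continuous_on {a..b} \<psi>" using assms(2) by (rule smooth_imp_continuous_on)
  then obtain B where B: "\<forall>x\<in>{a..b}. \<bar>\<psi> x\<bar> \<le> B"
    using compact_imp_bounded[OF compact_continuous_image[OF cont compact_Icc]]
    by (auto simp: bounded_iff)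
  have [measurable]: "\<psi> \<in> borel_measurable (lebesgue_on {a..b})" "u \<in> borel_measurable (lebesgue_on {a..b})"
    using assms(1) by (auto intro!: continuous_imp_measurable_on_sets_lebesgue cont)
  show ?thesis
    by (rule Bochner_Integration.integrable_bound[OF integrable_mult_left[OF integrable_norm[OF assms(1)], of B]])
      (use B in \<open>auto simp: abs_mult intro!: AE_I2 mult_left_mono intro: order_trans[OF _ abs_ge_self]\<close>)
qed auto


lemma interior_Omega: "interior Omega = {0<..<1}"
  by (simp add: interior_atLeastAtMost_real)

lemma integrable_imp_locally_integrable_on:
  assumes "integrable (lebesgue_on S) f" "S \<in> sets lebesgue" "U \<subseteq> S"
  shows "locally_integrable_on f U"
  unfolding locally_integrable_on_def
proof (intro allI impI)
  fix K assume "compact K" "K \<subseteq> U"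
  have "f absolutely_integrable_on S"
    using assms by (simp add: set_integrable_def integrable_restrict_space)
  then show "f absolutely_integrable_on K"
    by (rule set_integrable_subset)
      (use \<open>compact K\<close> \<open>K \<subseteq> U\<close> assms in \<open>auto intro: lmeasurable_compact fmeasurableD\<close>)
qed

lemma has_weak_derivativeI:
  assumes "integrable (lebesgue_on Omega) f" "integrable (lebesgue_on Omega) g"
    and "\<And>\<phi>. \<phi> \<in> test_functions (interior Omega) \<Longrightarrow>
      (LINT x|lebesgue_on Omega. f x * deriv \<phi> x) = - (LINT x|lebesgue_on Omega. g x * \<phi> x)"
  shows "has_weak_derivative f g"
  using assms interior_subset[of Omega]
  unfolding has_weak_derivative_def by (auto intro!: integrable_imp_locally_integrable_on[of Omega])

lemma has_weak_derivative_diff: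
  assumes "has_weak_derivative f f'" "has_weak_derivative g g'"
    and int: "integrable (lebesgue_on Omega) f" "integrable (lebesgue_on Omega) f'"
     "integrable (lebesgue_on Omega) g" "integrable (lebesgue_on Omega) g'"
  shows "has_weak_derivative (\<lambda>x. f x - g x) (\<lambda>x. f' x - g' x)"
proof (rule has_weak_derivativeI)
  fix \<phi> assume \<phi>: "\<phi> \<in> test_functions (interior Omega)"
  then have "smooth \<phi>" by (rule test_functionD)
  then show "(LINT x|lebesgue_on Omega. (f x - g x) * deriv \<phi> x) =
      - (LINT x|lebesgue_on Omega. (f' x - g' x) * \<phi> x)"
    using assms(1,2) \<phi> int by (simp add: left_diff_distrib integrable_mult_smooth smooth_deriv has_weak_derivative_def)
qed (use int in auto)

text \<open>The integral of \<open>deriv \<phi>\<close> is \<open>\<phi> 1 - \<phi> 0\<close>, and a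
  test function vanishes at both end points.\<close>

lemma has_weak_derivative_const: "has_weak_derivative (\<lambda>x. c) (\<lambda>x. 0)"
proof (rule has_weak_derivativeI)
  fix \<phi> assume \<phi>: "\<phi> \<in> test_functions (interior Omega)"
  then have sm: "smooth \<phi>" by (rule test_functionD)
  have "(deriv \<phi> has_integral \<phi> 1 - \<phi> 0) {0..1}"
    by (rule fundamental_theorem_of_calculus)
      (auto intro: smooth_imp_DERIV[OF sm, THEN has_field_derivative_at_within]
        simp flip: has_real_derivative_iff_has_vector_derivative)
  moreover have "\<phi> 0 = 0" "\<phi> 1 = 0"
    using test_functionD(2)[OF \<phi>] by (auto simp: interior_Omega)
  moreover have "integrable (lebesgue_on Omega) (deriv \<phi>)"
    using integrable_mult_smooth[of 0 1 "\<lambda>x. 1", OF _ smooth_deriv[OF sm]] by auto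
  ultimately show "(LINT x|lebesgue_on Omega. c * deriv \<phi> x) = - (LINT x|lebesgue_on Omega. 0 * \<phi> x)"
    by (auto simp: lebesgue_integral_eq_integral dest!: integral_unique)
qed auto

text \<open>Fubini on the triangle \<open>a \<le> y \<le> x \<le> b\<close>: integrating over
  \<open>x\<close> first turns \<open>deriv \<phi>\<close> into
  \<open>\<phi> b - \<phi> y = - \<phi> y\<close>.\<close>

lemma integral_primitive_mult_deriv:
  assumes g: "integrable (lebesgue_on {a..b}) g" and \<phi>: "smooth \<phi>" "\<phi> b = 0"
  shows "(LINT x|lebesgue_on {a..b}. integral {a..x} g * deriv \<phi> x) =
         - (LINT x|lebesgue_on {a..b}. g x * \<phi> x)"
proof -
  define p where "p = deriv \<phi>"
  have contp: "continuous_on A p" for A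
    unfolding p_def by (intro smooth_imp_continuous_on smooth_deriv \<phi>)
  have [measurable]: "p \<in> borel_measurable borel" "\<phi> \<in> borel_measurable borel"
    using contp smooth_imp_continuous_on[OF \<phi>(1)] by (auto intro: borel_measurable_continuous_onI)
  have gi: "integrable lebesgue (\<lambda>x. indicator {a..b} x * g x)"
    using g by (simp add: integrable_restrict_space)
  \<comment> \<open>Fubini is applied on the product of two copies of \<open>lborel\<close>, so the
    Lebesgue measurable \<open>g\<close> is replaced by a Borel representative. \<open>G\<close>
    cuts it off to vanish everywhere outside the interval, not just almost everywhere.\<close>
  then obtain G0 where [measurable]: "G0 \<in> borel_measurable lborel"
    and G0: "AE x in lborel. indicator {a..b} x * g x = G0 x"
    using completion_ex_borel_measurable_real[of "\<lambda>x. indicator {a..b} x * g x" lborel] by auto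
  define G where "G x = indicator {a..b} x * G0 x" for x
  have [measurable]: "G \<in> borel_measurable borel"
    unfolding G_def by measurable
  have G_AE: "AE x in lebesgue. indicator {a..b} x * g x = G x"
    using G0 unfolding AE_completion_iff by eventually_elim (auto simp: G_def split: split_indicator split_indicator_asm)
  have G_int: "integrable lborel G"
  proof -
    have "integrable lebesgue G"
      using gi G_AE by (subst integrable_cong_AE[symmetric]) (auto intro: measurable_completion)
    then show ?thesis by (simp add: integrable_completion)
  qed
  \<comment> \<open>Used twice: with \<open>q = 1\<close> for the primitive at \<open>x\<close>, and
    with \<open>q = \<phi>\<close> for the final integral.\<close>
  have to_G: "(LINT x|lebesgue_on S. g x * q x) = (LINT x|lborel. indicator S x * (G x * q x))"
    if S: "S \<in> sets borel" "S \<subseteq> {a..b}" and [measurable]: "q \<in> borel_measurable borel" for S q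
  proof -
    note [measurable] = S(1)
    have "(LINT x|lebesgue_on S. g x * q x) = (LINT x|lebesgue. indicator S x * (g x * q x))"
      using S by (simp add: integral_restrict_space)
    also have "\<dots> = (LINT x|lebesgue. indicator S x * ((indicator {a..b} x * g x) * q x))"
      using S by (intro Bochner_Integration.integral_cong) (auto simp: indicator_def)
    also have "\<dots> = (LINT x|lebesgue. indicator S x * (G x * q x))"
    proof (rule integral_cong_AE)
      have [measurable]: "q \<in> borel_measurable lebesgue" "G \<in> borel_measurable lebesgue" "S \<in> sets lebesgue"
        using S by (auto intro: measurable_completion)
      have [measurable]: "(\<lambda>x. indicator {a..b} x * g x) \<in> borel_measurable lebesgue"
        using gi by auto
      show "(\<lambda>x. indicator S x * ((indicator {a..b} x * g x) * q x)) \<in> borel_measurable lebesgue"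
        by measurable
      show "(\<lambda>x. indicator S x * (G x * q x)) \<in> borel_measurable lebesgue"
        by measurable
      show "AE x in lebesgue. indicator S x * ((indicator {a..b} x * g x) * q x) = indicator S x * (G x * q x)"
        using G_AE by eventually_elim simp
    qed
    also have "\<dots> = (LINT x|lborel. indicator S x * (G x * q x))"
      by (rule integral_completion) measurable
    finally show ?thesis .
  qed
  define F where "F x y = indicator {a..b} x * p x * (indicator {..x} y * G y)" for x y
  obtain B where B: "\<forall>x\<in>{a..b}. \<bar>p x\<bar> \<le> B"
    using compact_imp_bounded[OF compact_continuous_image[OF contp compact_Icc[of a b]]]
    by (auto simp: bounded_iff)
  \<comment> \<open>The majorant is a product of an integrable function of \<open>x\<close> and an
    integrable function of \<open>y\<close>.\<close>
  have F_int: "integrable (lborel \<Otimes>\<^sub>M lborel) (case_prod F)"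
  proof (rule Bochner_Integration.integrable_bound)
    show "integrable (lborel \<Otimes>\<^sub>M lborel) (\<lambda>(x, y). (indicator {a..b} x * B) * \<bar>G y\<bar>)"
    proof (rule lborel_pair.Fubini_integrable)
      have "integrable lborel (\<lambda>x. (indicator {a..b} x * \<bar>B\<bar>) * (LINT y|lborel. \<bar>G y\<bar>))"
        by (intro integrable_mult_left integrable_real_indicator) (auto simp: emeasure_lborel_Icc_eq)
      then show "integrable lborel (\<lambda>x. LINT y|lborel. norm (case (x, y) of (x, y) \<Rightarrow> (indicator {a..b} x * B) * \<bar>G y\<bar>))"
        by (simp add: abs_mult)
      show "AE x in lborel. integrable lborel (\<lambda>y. case (x, y) of (x, y) \<Rightarrow> (indicator {a..b} x * B) * \<bar>G y\<bar>)"
        using G_int by auto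
    qed measurable
    have "(\<lambda>(x, y). indicator {a..b} x * p x * ((if y \<le> x then 1 else 0) * G y)) \<in> borel_measurable (lborel \<Otimes>\<^sub>M lborel)"
      by measurable
    also have "(\<lambda>(x, y). indicator {a..b} x * p x * ((if y \<le> x then 1 else 0) * G y)) = case_prod F"
      by (auto simp: F_def fun_eq_iff indicator_def)
    finally show "case_prod F \<in> borel_measurable (lborel \<Otimes>\<^sub>M lborel)" .
    show "AE z in lborel \<Otimes>\<^sub>M lborel. norm (case z of (x, y) \<Rightarrow> F x y) \<le> norm (case z of (x, y) \<Rightarrow> (indicator {a..b} x * B) * \<bar>G y\<bar>)"
      by (rule AE_I2) (auto simp: F_def indicator_def abs_mult intro!: mult_right_mono order_trans[OF B[rule_format] abs_ge_self])
  qed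
  have "(LINT x|lebesgue_on {a..b}. integral {a..x} g * p x) = (LINT x|lebesgue. indicator {a..b} x * (integral {a..x} g * p x))"
    by (simp add: integral_restrict_space)
  also have "\<dots> = (LINT x|lebesgue. (LINT y|lborel. F x y))"
  proof (intro Bochner_Integration.integral_cong refl)
    fix x
    show "indicator {a..b} x * (integral {a..x} g * p x) = (LINT y|lborel. F x y)"
    proof (cases "x \<in> {a..b}")
      case True
      have "integrable (lebesgue_on {a..x}) g"
        using integrable_subinterval[OF g] True by simp
      then have "integral {a..x} g = (LINT y|lebesgue_on {a..x}. g y * 1)"
        by (simp add: lebesgue_integral_eq_integral)
      also have "\<dots> = (LINT y|lborel. indicator {a..x} y * (G y * 1))"
        using True by (intro to_G) auto
      also have "\<dots> = (LINT y|lborel. indicator {..x} y * G y)"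
        by (intro Bochner_Integration.integral_cong) (auto simp: G_def indicator_def)
      finally show ?thesis using True by (simp add: F_def)
    qed (simp add: F_def)
  qed
  \<comment> \<open>By \<open>F_int\<close> the inner integral is Borel measurable in
    \<open>x\<close>, so completing the outer measure changes nothing.\<close>
  also have "\<dots> = (LINT x|lborel. (LINT y|lborel. F x y))"
    using lborel_pair.integrable_fst[OF F_int] by (intro integral_completion) auto
  also have "\<dots> = (LINT y|lborel. (LINT x|lborel. F x y))"
    by (rule lborel_pair.Fubini_integral[OF F_int, symmetric])
  also have "\<dots> = (LINT y|lborel. - (indicator {a..b} y * (G y * \<phi> y)))"
  proof (intro Bochner_Integration.integral_cong refl)
    fix y
    show "(LINT x|lborel. F x y) = - (indicator {a..b} y * (G y * \<phi> y))"
    proof (cases "y \<in> {a..b}")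
      case True
      \<comment> \<open>For fixed \<open>y\<close> the section lives on \<open>{y..b}\<close>, where
        the fundamental theorem evaluates it.\<close>
      have "(LINT x|lborel. F x y) = (LINT x|lborel. G y * (indicator {y..b} x *\<^sub>R p x))"
        using True by (intro Bochner_Integration.integral_cong) (auto simp: F_def indicator_def)
      also have "\<dots> = G y * (\<phi> b - \<phi> y)"
        using True by (subst integral_mult_right_zero, subst integral_FTC_atLeastAtMost[of y b \<phi> p])
          (auto intro: contp[unfolded p_def] smooth_imp_DERIV[OF \<phi>(1), THEN has_field_derivative_at_within]
            simp: p_def simp flip: has_real_derivative_iff_has_vector_derivative)
      finally show ?thesis using True \<phi>(2) by simp
    qed (simp add: F_def G_def)
  qed
  also have "\<dots> = - (LINT x|lebesgue_on {a..b}. g x * \<phi> x)"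
    by (subst to_G) auto
  finally show ?thesis by (simp add: p_def)
qed

lemma has_weak_derivative_primitive:
  assumes "integrable (lebesgue_on Omega) g"
  shows "continuous_on Omega (\<lambda>x. integral {0..x} g)"
    "has_weak_derivative (\<lambda>x. integral {0..x} g) g"
proof -
  have "g integrable_on Omega"
    using assms by (simp add: integrable_on_lebesgue_on)
  then show cont: "continuous_on Omega (\<lambda>x. integral {0..x} g)"
    by (rule indefinite_integral_continuous_1)
  show "has_weak_derivative (\<lambda>x. integral {0..x} g) g"
  proof (rule has_weak_derivativeI)
    fix \<phi> assume "\<phi> \<in> test_functions (interior Omega)"
    then show "(LINT x|lebesgue_on Omega. integral {0..x} g * deriv \<phi> x) = - (LINT x|lebesgue_on Omega. g x * \<phi> x)"
      by (intro integral_primitive_mult_deriv assms) (auto dest: test_functionD simp: interior_Omega)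
  qed (use assms cont continuous_imp_integrable_real in auto)
qed

section \<open>Functions with vanishing weak derivative\<close>

text \<open>
  The factor \<open>n + 2\<close> moves the support inside the open interval, and
  \<open>exp (- 1 / ((n + 2) d - 1)) \<longlongrightarrow> 1\<close> for each fixed distance \<open>d > 0\<close> to an end point.
\<close>

definition plateau :: "real \<Rightarrow> real \<Rightarrow> nat \<Rightarrow> real \<Rightarrow> real" where
  "plateau a b n x =
     poly_bump 1 (real (n + 2) * (x - a) - 1) * poly_bump 1 (real (n + 2) * (b - x) - 1)"

lemma plateau_in_bump_algebra: "plateau a b n \<in> bump_algebra"
proof -
  have "plateau a b n = (\<lambda>x. poly_bump 1 (real (n + 2) * x + (- real (n + 2) * a - 1)) *
      poly_bump 1 (- real (n + 2) * x + (real (n + 2) * b - 1)))"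
    unfolding plateau_def by (intro ext) (simp add: algebra_simps)
  then show ?thesis by (simp only: bump_algebra.intros)
qed

lemma poly_bump_1_bounds: "0 \<le> poly_bump 1 x" "poly_bump 1 x \<le> 1"
  by (auto simp: poly_bump_def)

lemma plateau_bound: "\<bar>plateau a b n x\<bar> \<le> 1"
  using poly_bump_1_bounds by (auto simp: plateau_def abs_mult intro!: mult_le_one)

lemma plateau_eq_0:
  assumes "x \<notin> {a + 1 / real (n + 2)..b - 1 / real (n + 2)}"
  shows "plateau a b n x = 0"
proof -
  have "real (n + 2) * (x - a) < 1 \<or> real (n + 2) * (b - x) < 1"
    using assms by (auto simp: field_simps not_le)
  then show ?thesis by (auto simp: plateau_def poly_bump_def)
qed

lemma plateau_tendsto: "(\<lambda>n. plateau a b n x) \<longlonglongrightarrow> indicator {a<..<b} x"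
proof (cases "x \<in> {a<..<b}")
  case True
  have *: "(\<lambda>n. poly_bump 1 (real (n + 2) * d - 1)) \<longlonglongrightarrow> 1" if "d > 0" for d
  proof -
    have lim: "filterlim (\<lambda>n. real (n + 2) * d - 1) at_top sequentially"
      using that by real_asymp
    have "((\<lambda>y::real. exp (- (1 / y))) \<longlongrightarrow> 1) at_top" by real_asymp
    from filterlim_compose[OF this lim]
    have "(\<lambda>n. exp (- (1 / (real (n + 2) * d - 1)))) \<longlonglongrightarrow> 1" .
    moreover have "eventually (\<lambda>n. real (n + 2) * d - 1 > 0) sequentially"
      using lim by (rule filterlim_at_top_dense[THEN iffD1, rule_format])
    ultimately show ?thesis
      by (elim Lim_transform_eventually eventually_mono) (auto simp: poly_bump_def)
  qed
  show ?thesis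
    using tendsto_mult[OF *[of "x - a"] *[of "b - x"]] True by (simp add: plateau_def)
next
  case False
  have "plateau a b n x = 0" for n
  proof (rule plateau_eq_0)
    have "0 < 1 / real (n + 2)" by simp
    with False show "x \<notin> {a + 1 / real (n + 2)..b - 1 / real (n + 2)}"
      unfolding greaterThanLessThan_iff atLeastAtMost_iff by linarith
  qed
  then show ?thesis using False by simp
qed

text \<open>Plateaus are bounded by 1, so \<open>\<bar>u\<bar>\<close> is an integrable
  majorant.\<close>

lemma tendsto_integral_plateau:
  assumes "integrable (lebesgue_on {c..d}) u"
  shows "(\<lambda>n. LINT x|lebesgue_on {c..d}. u x * plateau a b n x)
    \<longlonglongrightarrow> (LINT x|lebesgue_on {c..d}. u x * indicator {a<..<b} x)"
proof (rule integral_dominated_convergence[where w="\<lambda>x. \<bar>u x\<bar>"])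
  show "(\<lambda>x. u x * indicator {a<..<b} x) \<in> borel_measurable (lebesgue_on {c..d})"
    by (rule borel_measurable_times[OF _ measurable_restrict_space1[OF borel_measurable_indicator]])
      (use assms in auto)
  show "(\<lambda>x. u x * plateau a b n x) \<in> borel_measurable (lebesgue_on {c..d})" for n
    using integrable_mult_smooth[OF assms smooth_bump_algebra[OF plateau_in_bump_algebra]] by auto
  show "integrable (lebesgue_on {c..d}) (\<lambda>x. \<bar>u x\<bar>)" using assms by simp
  show "AE x in lebesgue_on {c..d}. (\<lambda>n. u x * plateau a b n x) \<longlonglongrightarrow> u x * indicator {a<..<b} x"
    by (intro AE_I2 tendsto_mult tendsto_const plateau_tendsto)
  show "AE x in lebesgue_on {c..d}. norm (u x * plateau a b n x) \<le> \<bar>u x\<bar>" for n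
    using mult_left_mono[OF plateau_bound abs_ge_zero] by (intro AE_I2) (auto simp: abs_mult)
qed

text \<open>Each bump weighted by the integral of the other, their difference has mean zero and is
  therefore the derivative of a test function, against which \<open>u\<close> integrates to 0. The
  cross-multiplied form avoids dividing by an integral before passing to the limit.\<close>

lemma weakly_constant_integral_mult:
  assumes u: "integrable (lebesgue_on Omega) u" "has_weak_derivative u (\<lambda>x. 0)"
    and \<psi>: "\<psi>1 \<in> bump_algebra" "\<psi>2 \<in> bump_algebra"
    and supp: "\<And>x. x \<notin> {s..t} \<Longrightarrow> \<psi>1 x = 0" "\<And>x. x \<notin> {s..t} \<Longrightarrow> \<psi>2 x = 0"
    and st: "0 < s" "s \<le> t" "t < 1"
  shows "(LINT x|lebesgue_on Omega. \<psi>1 x) * (LINT x|lebesgue_on Omega. u x * \<psi>2 x) =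
         (LINT x|lebesgue_on Omega. \<psi>2 x) * (LINT x|lebesgue_on Omega. u x * \<psi>1 x)"
proof -
  let ?I = "\<lambda>f::real \<Rightarrow> real. LINT x|lebesgue_on Omega. f x"
  define \<psi> where "\<psi> x = ?I \<psi>1 * \<psi>2 x + (- ?I \<psi>2) * \<psi>1 x" for x
  note sm = smooth_bump_algebra[OF \<psi>(1)] smooth_bump_algebra[OF \<psi>(2)]
  have "\<psi> \<in> bump_algebra"
    unfolding \<psi>_def using \<psi> by (intro bump_algebra.intros)
  then have \<psi>_sm: "smooth \<psi>" by (rule smooth_bump_algebra)
  have int: "integrable (lebesgue_on Omega) \<psi>1" "integrable (lebesgue_on Omega) \<psi>2"
    using integrable_mult_smooth[of 0 1 "\<lambda>x. 1"] sm by auto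
  have "?I \<psi> = 0"
    unfolding \<psi>_def using int by (subst Bochner_Integration.integral_add) auto
  moreover have "integrable (lebesgue_on Omega) \<psi>"
    using integrable_mult_smooth[of 0 1 "\<lambda>x. 1"] \<psi>_sm by auto
  ultimately have "integral {0..1} \<psi> = 0"
    by (simp add: lebesgue_integral_eq_integral)
  moreover have "\<psi> x = 0" if "x \<notin> {s..t}" for x
    using supp that by (simp add: \<psi>_def)
  ultimately obtain \<phi> where "\<phi> \<in> test_functions {0<..<1}" "deriv \<phi> = \<psi>"
    using mean_zero_imp_deriv_test_function[OF \<psi>_sm, of s t 0 1] st by blast
  then have "?I (\<lambda>x. u x * \<psi> x) = 0"
    using u(2) by (auto simp: has_weak_derivative_def)
  moreover have "?I (\<lambda>x. u x * \<psi> x) = ?I (\<lambda>x. ?I \<psi>1 * (u x * \<psi>2 x) + (- ?I \<psi>2) * (u x * \<psi>1 x))"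
    by (simp add: \<psi>_def algebra_simps)
  moreover have "\<dots> = ?I \<psi>1 * ?I (\<lambda>x. u x * \<psi>2 x) + (- ?I \<psi>2) * ?I (\<lambda>x. u x * \<psi>1 x)"
    using integrable_mult_smooth[OF u(1)] sm
    by (subst Bochner_Integration.integral_add) auto
  ultimately show ?thesis by simp
qed

text \<open>Compare the plateaus over the unit interval and over \<open>{a<..<b}\<close>; as
  \<open>n\<close> grows, their masses tend to 1 and \<open>b - a\<close>.\<close>

lemma weakly_constant_integral_interval:
  assumes u: "integrable (lebesgue_on Omega) u" "has_weak_derivative u (\<lambda>x. 0)"
    and ab: "0 \<le> a" "a \<le> b" "b \<le> 1"
  shows "(LINT x|lebesgue_on Omega. u x * indicator {a<..<b} x) = (b - a) * (LINT x|lebesgue_on Omega. u x)"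
proof -
  have supp: "plateau c d n x = 0"
    if "0 \<le> c" "d \<le> 1" "x \<notin> {1 / real (n + 2)..1 - 1 / real (n + 2)}" for c d n x
    by (rule plateau_eq_0) (use that in auto)
  \<comment> \<open>Both plateaus are supported in the same closed interval, which is nonempty
    because \<open>n + 2 \<ge> 2\<close> gives \<open>1 / (n + 2) \<le> 1 - 1 / (n + 2)\<close>,
    even for \<open>n = 0\<close>.\<close>
  have *: "(LINT x|lebesgue_on Omega. plateau 0 1 n x) * (LINT x|lebesgue_on Omega. u x * plateau a b n x) =
         (LINT x|lebesgue_on Omega. plateau a b n x) * (LINT x|lebesgue_on Omega. u x * plateau 0 1 n x)" for n
    by (rule weakly_constant_integral_mult[OF u plateau_in_bump_algebra plateau_in_bump_algebra,
          of "1 / real (n + 2)" "1 - 1 / real (n + 2)"])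
      (rule supp | use ab in \<open>simp add: field_simps\<close>)+
  have m: "(LINT x|lebesgue_on Omega. indicator {c<..<d} x) = d - c" if "0 \<le> c" "c \<le> d" "d \<le> 1" for c d :: real
  proof -
    have "(LINT x|lebesgue_on Omega. indicator {c<..<d} x) =
        (LINT x|lebesgue. indicator Omega x *\<^sub>R (indicator {c<..<d} x :: real))"
      by (rule integral_restrict_space) simp
    also have "\<dots> = (LINT x|lebesgue. indicator {c<..<d} x)"
      using that by (intro Bochner_Integration.integral_cong) (auto simp: indicator_def)
    finally show ?thesis using that by simp
  qed
  have U: "(LINT x|lebesgue_on Omega. u x * indicator {0<..<1} x) = (LINT x|lebesgue_on Omega. u x)"
  proof (rule integral_cong_AE)
    show "(\<lambda>x. u x * indicator {0<..<1} x) \<in> borel_measurable (lebesgue_on Omega)"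
      by (rule borel_measurable_times[OF _ measurable_restrict_space1[OF borel_measurable_indicator]])
        (use u(1) in auto)
    show "AE x in lebesgue_on Omega. u x * indicator {0<..<1} x = u x"
      unfolding AE_restrict_space_iff[of Omega lebesgue, simplified]
      by (rule AE_I'[of "{0, 1}"]) (auto simp: indicator_def negligible_iff_null_sets[symmetric])
  qed (use u in auto)
  \<comment> \<open>With the constant function 1 the convergence lemma gives the limits of the
    masses.\<close>
  have "integrable (lebesgue_on Omega) (\<lambda>x. 1::real)" by auto
  note lims = tendsto_integral_plateau[OF this, simplified]
  have "(\<lambda>n. (LINT x|lebesgue_on Omega. plateau 0 1 n x) * (LINT x|lebesgue_on Omega. u x * plateau a b n x))
     \<longlonglongrightarrow> (1 - 0) * (LINT x|lebesgue_on Omega. u x * indicator {a<..<b} x)"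
    using lims[of 0 1] m[of 0 1] by (intro tendsto_mult tendsto_integral_plateau u) simp
  \<comment> \<open>The same sequence rewritten by \<open>*\<close>; uniqueness of limits equates
    the two values.\<close>
  moreover have "(\<lambda>n. (LINT x|lebesgue_on Omega. plateau 0 1 n x) * (LINT x|lebesgue_on Omega. u x * plateau a b n x))
     \<longlonglongrightarrow> (b - a) * (LINT x|lebesgue_on Omega. u x * indicator {0<..<1} x)"
    unfolding * using lims[of a b] m[of a b] ab by (intro tendsto_mult tendsto_integral_plateau u) simp
  ultimately show ?thesis
    using LIMSEQ_unique U by fastforce
qed

lemma weakly_constant_AE_eq_const:
  assumes u: "integrable (lebesgue_on Omega) u" "has_weak_derivative u (\<lambda>x. 0)"
  shows "AE x in lebesgue_on Omega. u x = (LINT t|lebesgue_on Omega. u t)"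
proof -
  define c where "c = (LINT t|lebesgue_on Omega. u t)"
  \<comment> \<open>Extension by zero, since the differentiation theorem asks for integrability on
    every interval of the line.\<close>
  define g where "g x = indicator Omega x * (u x - c)" for x
  have int_uc: "integrable (lebesgue_on Omega) (\<lambda>x. u x - c)"
    using u(1) by auto
  then have g_int: "integrable lebesgue g"
    by (simp add: integrable_restrict_space g_def[abs_def])
  then have "g absolutely_integrable_on UNIV"
    by (simp add: set_integrable_def)
  then have g_abs: "g absolutely_integrable_on S" if "S \<in> sets lebesgue" for S
    using that by (rule set_integrable_subset) auto
  then have "g integrable_on cbox a b" for a b
    by (auto intro!: set_lebesgue_integral_eq_integral(1))
  then obtain N where N: "negligible N" and diff: "\<And>x e. \<lbrakk>x \<notin> N; 0 < e\<rbrakk> \<Longrightarrow>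
      \<exists>d>0. \<forall>h. 0 < h \<and> h < d \<longrightarrow> \<bar>integral {x..x + h} g / h - g x\<bar> < e"
    using integrable_ccontinuous_explicit[of g] by (auto simp: divide_inverse mult.commute)
  have zero: "integral {a..b} g = 0" if ab: "0 \<le> a" "a \<le> b" "b \<le> 1" for a b
  proof -
    have "integral {a..b} g = integral {a<..<b} g"
      by (simp add: integral_open_interval_real)
    also have "\<dots> = (LINT x:{a<..<b}|lebesgue. g x)"
      by (intro set_lebesgue_integral_eq_integral(2)[symmetric] g_abs) auto
    also have "\<dots> = (LINT x|lebesgue. indicator Omega x * ((u x - c) * indicator {a<..<b} x))"
      by (simp add: set_lebesgue_integral_def g_def mult_ac)
    also have "\<dots> = (LINT x|lebesgue_on Omega. (u x - c) * indicator {a<..<b} x)"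
      by (simp add: integral_restrict_space)
    also have "\<dots> = (b - a) * (LINT x|lebesgue_on Omega. u x - c)"
    proof (rule weakly_constant_integral_interval[OF int_uc _ ab])
      show "has_weak_derivative (\<lambda>x. u x - c) (\<lambda>x. 0)"
        using has_weak_derivative_diff[OF u(2) has_weak_derivative_const] u by simp
    qed
    \<comment> \<open>\<open>Omega\<close> has measure 1, so subtracting the integral of
      \<open>u\<close> leaves mean zero.\<close>
    also have "(LINT x|lebesgue_on Omega. u x - c) = 0"
      using u(1) by (subst Bochner_Integration.integral_diff) (auto simp: c_def measure_restrict_space)
    finally show ?thesis by simp
  qed
  have "u x = c" if "x \<in> {0<..<1}" "x \<notin> N" for x
  proof (rule ccontr)
    assume "u x \<noteq> c"
    \<comment> \<open>With \<open>\<bar>g x\<bar>\<close> as the tolerance and vanishing averages,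
      differentiation at \<open>x\<close> would give
      \<open>\<bar>g x\<bar> < \<bar>g x\<bar>\<close>.\<close>
    then have "\<bar>g x\<bar> > 0" using that by (auto simp: g_def)
    from diff[OF that(2) this] obtain d where "d > 0"
      and d: "\<And>h. 0 < h \<Longrightarrow> h < d \<Longrightarrow> \<bar>integral {x..x + h} g / h - g x\<bar> < \<bar>g x\<bar>" by blast
    \<comment> \<open>Halving \<open>d\<close> keeps \<open>h\<close> strictly below it;
      \<open>1 - x\<close> keeps \<open>x + h\<close> in \<open>Omega\<close>.\<close>
    define h where "h = min (d / 2) (1 - x)"
    have "0 < h" "h < d" "x + h \<le> 1"
      using that \<open>d > 0\<close> by (auto simp: h_def min_def)
    then show False
      using d[of h] zero[of x "x + h"] that by auto
  qed
  then show ?thesis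
    unfolding AE_restrict_space_iff[of Omega lebesgue, simplified] c_def[symmetric]
    by (intro AE_I'[of "N \<union> {0, 1}"])
      (use N in \<open>force simp: negligible_iff_null_sets[symmetric]\<close>)+
qed

section \<open>The orthogonal decomposition\<close>

text \<open>Inside the interval the set of disagreement is open and negligible, hence empty;
  continuity carries the equality to the end points.\<close>

lemma AE_eq_continuous_imp_eq:
  fixes f g :: "real \<Rightarrow> real"
  assumes "continuous_on {a..b} f" "continuous_on {a..b} g"
    and "AE x in lebesgue_on {a..b}. f x = g x" and "a < b" "x \<in> {a..b}"
  shows "f x = g x"
proof -
  let ?d = "\<lambda>x. f x - g x"
  have cont: "continuous_on {a..b} ?d" by (intro continuous_intros assms)
  let ?D = "{a<..<b} \<inter> ?d -` (- {0})"
  have "open ?D"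
    by (intro continuous_open_preimage continuous_on_subset[OF cont]) auto
  moreover have "negligible ?D"
  proof -
    have "AE x in lebesgue. x \<in> {a..b} \<longrightarrow> f x = g x"
      using assms(3) by (simp add: AE_restrict_space_iff)
    then obtain N where "N \<in> null_sets lebesgue"
      and N: "{x \<in> space lebesgue. \<not> (x \<in> {a..b} \<longrightarrow> f x = g x)} \<subseteq> N"
      unfolding eventually_ae_filter by blast
    then have "negligible N" by (simp add: negligible_iff_null_sets)
    moreover have "?D \<subseteq> {x \<in> space lebesgue. \<not> (x \<in> {a..b} \<longrightarrow> f x = g x)}"
      by auto
    then have "?D \<subseteq> N" using N by (rule subset_trans)
    ultimately show ?thesis by (rule negligible_subset)
  qed
  ultimately have "?D = {}" using open_not_negligible by blast
  then have "?d y = 0" if "y \<in> {a<..<b}" for y using that by auto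
  then have "?d x = 0"
    using continuous_constant_on_closure[of "{a<..<b}" ?d 0 x] cont assms by simp
  then show ?thesis by simp
qed

section \<open>Square-integrable functions on the unit interval\<close>

lemma L2_imp_integrable: "f \<in> L2 \<Longrightarrow> integrable (lebesgue_on Omega) f"
  unfolding L2_def
  by (auto intro!: finite_measure.square_integrable_imp_integrable finite_measure_lebesgue_on)

lemma continuous_on_imp_L2: "continuous_on Omega f \<Longrightarrow> f \<in> L2"
  unfolding L2_def
  by (auto intro!: continuous_imp_integrable_real continuous_imp_measurable_on_sets_lebesgue continuous_intros)

lemma L2_diff_const: "f \<in> L2 \<Longrightarrow> (\<lambda>x. f x - c) \<in> L2"
proof -
  assume f: "f \<in> L2"
  then have "integrable (lebesgue_on Omega) (\<lambda>x. (f x)\<^sup>2 - 2 * c * f x + c\<^sup>2)"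
    using L2_imp_integrable[OF f] by (auto simp: L2_def)
  moreover have "(\<lambda>x. (f x)\<^sup>2 - 2 * c * f x + c\<^sup>2) = (\<lambda>x. (f x - c)\<^sup>2)"
    by (auto simp: power2_eq_square algebra_simps)
  ultimately show ?thesis using f by (auto simp: L2_def)
qed

text \<open>Here \<open>h\<close> and the primitive \<open>H\<close> of \<open>v\<close> share the
  weak derivative \<open>v\<close>, so the continuous representative \<open>w\<close> of
  \<open>h\<close> equals \<open>H + C\<close> everywhere. The zero trace then forces
  \<open>H 1 = H 0 = 0\<close>, and \<open>H 1\<close> is the integral of \<open>v\<close>.\<close>

lemma D_W12_0_integral_eq_0:
  assumes "v \<in> D_W12_0"
  shows "(LINT x|lebesgue_on Omega. v x) = 0"
proof -
  obtain h w where v: "v \<in> L2" and h: "h \<in> L2" "has_weak_derivative h v"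
    and w: "continuous_on Omega w" "AE x in lebesgue_on Omega. h x = w x" "w 0 = 0" "w 1 = 0"
    using assms
    by (auto simp: D_W12_0_def W12_0_def W12_def continuous_representative_def frontier_def interior_Omega)
  note v_int = L2_imp_integrable[OF v]
  define H where "H x = integral {0..x} v" for x
  note H = has_weak_derivative_primitive[OF v_int, folded H_def]
  note H_int = continuous_imp_integrable_real[OF H(1)]
  note h_int = L2_imp_integrable[OF h(1)]
  have "has_weak_derivative (\<lambda>x. h x - H x) (\<lambda>x. 0)"
    using has_weak_derivative_diff[OF h(2) H(2) h_int v_int H_int v_int] by simp
  then obtain C where C: "AE x in lebesgue_on Omega. h x - H x = C"
    using weakly_constant_AE_eq_const h_int H_int by blast
  have "w x = H x + C" if "x \<in> Omega" for x
  proof (rule AE_eq_continuous_imp_eq[OF w(1) _ _ _ that])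
    show "AE x in lebesgue_on Omega. w x = H x + C"
      using C w(2) by eventually_elim simp
  qed (auto intro!: continuous_intros H)
  \<comment> \<open>At 0 this gives \<open>C = 0\<close>, since \<open>H 0 = 0\<close>; at 1 it then
    gives \<open>H 1 = w 1 = 0\<close>.\<close>
  from this[of 0] this[of 1] have "H 1 = 0"
    using w by (simp add: H_def)
  then show ?thesis
    using v_int by (simp add: H_def lebesgue_integral_eq_integral)
qed

theorem proposition2:
  fixes f :: "real \<Rightarrow> real"
  assumes "f \<in> L2"
  shows "(\<exists>h\<in>W12_0. \<exists>Dh. has_weak_derivative h Dh \<and>
            (AE x in lebesgue_on Omega. f x = (LINT t|lebesgue_on Omega. f t) + Dh x) \<and>
            Dh \<in> D_W12_0) \<and>
         (\<lambda>x. LINT t|lebesgue_on Omega. f t) \<in> A2 \<and>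
         (\<forall>u\<in>A2. \<forall>v\<in>D_W12_0. L2_inner u v = 0)"
proof (intro conjI ballI)
  define c where "c = (LINT t|lebesgue_on Omega. f t)"
  define g where "g = (\<lambda>x. f x - c)"
  have g: "g \<in> L2" unfolding g_def by (rule L2_diff_const[OF assms])
  note g_int = L2_imp_integrable[OF g]
  \<comment> \<open>The witness for \<open>h\<close>; \<open>H 1\<close> is the mean of
    \<open>g\<close>, which is zero by the choice of \<open>c\<close>. Being continuous,
    \<open>H\<close> is its own continuous representative.\<close>
  define H where "H x = integral {0..x} g" for x
  note H = has_weak_derivative_primitive[OF g_int, folded H_def]
  have "(LINT x|lebesgue_on Omega. g x) = 0"
    using L2_imp_integrable[OF assms]
    by (simp add: g_def c_def measure_restrict_space)
  then have "H 0 = 0" "H 1 = 0"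
    using g_int by (auto simp: H_def lebesgue_integral_eq_integral)
  then have "continuous_representative H H \<and> (\<forall>x\<in>frontier Omega. H x = 0)"
    using H(1) by (auto simp: continuous_representative_def frontier_def interior_Omega)
  moreover have "H \<in> W12"
    using H(2) g continuous_on_imp_L2[OF H(1)] unfolding W12_def by blast
  ultimately have "H \<in> W12_0"
    unfolding W12_0_def by blast
  moreover from this have "g \<in> D_W12_0"
    using g H(2) unfolding D_W12_0_def by blast
  ultimately show "\<exists>h\<in>W12_0. \<exists>Dh. has_weak_derivative h Dh \<and>
      (AE x in lebesgue_on Omega. f x = (LINT t|lebesgue_on Omega. f t) + Dh x) \<and> Dh \<in> D_W12_0"
    using H(2) by (intro bexI[of _ H] exI[of _ g]) (simp_all add: g_def c_def)
  show "(\<lambda>x. LINT t|lebesgue_on Omega. f t) \<in> A2"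
    unfolding A2_def using has_weak_derivative_const by (auto intro: continuous_on_imp_L2)
next
  fix u v assume u: "u \<in> A2" and v: "v \<in> D_W12_0"
  define c where "c = (LINT t|lebesgue_on Omega. u t)"
  have u_int: "integrable (lebesgue_on Omega) u" and v_int: "integrable (lebesgue_on Omega) v"
    using u v by (auto simp: A2_def D_W12_0_def intro: L2_imp_integrable)
  \<comment> \<open>Once \<open>u\<close> is replaced by a constant, the inner product is that
    constant times the integral of \<open>v\<close>, which vanishes.\<close>
  have "AE x in lebesgue_on Omega. u x = c"
    using u u_int unfolding c_def by (intro weakly_constant_AE_eq_const) (auto simp: A2_def)
  then have "L2_inner u v = (LINT x|lebesgue_on Omega. c * v x)"
    unfolding L2_inner_def using u_int v_int by (intro integral_cong_AE) auto
  then show "L2_inner u v = 0"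
    using D_W12_0_integral_eq_0[OF v] by simp
qed

end
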